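(* Let $N > 2$ be an integer. The only two-stage, second-order, $N$-split operator-splitting methods with complex coefficients are the following two. That is, a two-stage, $N$-split operator-splitting method with coefficients $\alpha_k^{[\ell]} \in \mathbb{C}$ ($k = 1,2$; $\ell = 1,\dots,N$) is of order two if and only if either $$\alpha_1^{[\ell]} = \tfrac12 + \tfrac{i}{2} \ \text{ and }\ \alpha_2^{[\ell]} = \tfrac12 - \tfrac{i}{2} \quad \text{for all } \ell = 1,2,\dots,N,$$ or $$\alpha_1^{[\ell]} = \tfrac12 - \tfrac{i}{2} \ \text{ and }\ \alpha_2^{[\ell]} = \tfrac12 + \tfrac{i}{2} \quad \text{for all } \ell = 1,2,\dots,N.$$
   Context: Consider an additively split ODE $\frac{dy}{dt} = \mathcal{F}(t,y) = \sum_{\ell=1}^{N} \mathcal{F}^{[\ell]}(t,y)$, and let $\varphi_t^{[\ell]}$ be the exact flow of the subsystem $\frac{dy^{[\ell]}}{dt} = \mathcal{F}^{[\ell]}(t,y^{[\ell]})$. An $s$-stage, $N$-split operator-splitting method with step size $h$ and coefficients $\{\alpha_k^{[\ell]}\}_{k=1,\dots,s}^{\ell=1,\dots,N}$ is the composition $$\Psi_{h} = \varphi^{[N]}_{\alpha_s^{[N]}h} \circ \cdots \circ \varphi^{[1]}_{\alpha_s^{[1]}h} \circ \cdots \circ \varphi^{[N]}_{\alpha_1^{[N]}h} \circ \cdots \circ \varphi^{[1]}_{\alpha_1^{[1]}h}.$$ In terms of the Lie derivatives $D_\ell = \sum_j \mathcal{F}^{[\ell]}_j \frac{\partial}{\partial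 y_j}$ (which in general do not commute), it is written as $$\Psi_h(y_0) = \exp(\alpha_1^{[1]}hD_1)\exp(\alpha_1^{[2]}hD_2)\cdots\exp(\alpha_1^{[N]}hD_N)\,\cdots\,\exp(\alpha_s^{[1]}hD_1)\cdots\exp(\alpha_s^{[N]}hD_N)\, y_0,$$ while the exact solution is $\exp(h(D_1+\cdots+D_N))\,y_0$. The coefficients are allowed to be complex. The method is of order two (second-order) if the two operator expressions agree up to and including the terms in $h^2$ for general (non-commuting) operators: regarding $D_1,\dots,D_N$ as free non-commuting indeterminates over $\mathbb{C}$, the formal power series in $h$ $$\prod_{k=1}^s\Big(\prod_{\ell=1}^N \exp(\alpha_k^{[\ell]} h D_\ell)\Big) \quad\text{and}\quad \exp\big(h(D_1+\cdots+D_N)\big)$$ (products ordered left to right by increasing index) coincide modulo $h^3$. *)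

theory Defs
  imports
    Complex_Main
    "HOL-Library.Poly_Mapping"
    "HOL-Computational_Algebra.Formal_Power_Series"
begin

unbundle fps_syntax

text \<open>
  Words over \<^typ>\<open>'a\<close> form the free monoid. It is written additively because
  \<^type>\<open>poly_mapping\<close> takes its convolution product over an additive monoid of
  exponents. A type of its own is used instead of \<^typ>\<open>'a list\<close> so as not to fix
  one particular addition on lists.
\<close>

datatype 'a free_monoid = Word (letters: "'a list")

instantiation free_monoid :: (type) monoid_add
begin

definition "0 = Word []"

definition "u + v = Word (letters u @ letters v)"

instance
  by standard (simp_all add: zero_free_monoid_def plus_free_monoid_def)

end

text \<open>
  The free associative unital algebra over the complex numbers on the non-commuting
  indeterminates \<open>D\<^sub>0, D\<^sub>1, D\<^sub>2, \<dots>\<close>. An \<open>N\<close>-split method involves only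
  \<open>D\<^sub>1, \<dots>, D\<^sub>N\<close>, which generate the free algebra on \<open>N\<close> indeterminates.
\<close>

type_synonym free_alg = "nat free_monoid \<Rightarrow>\<^sub>0 complex"

definition indet :: "nat \<Rightarrow> free_alg" where
  "indet l = Poly_Mapping.single (Word [l]) 1"

definition scalar :: "complex \<Rightarrow> free_alg" where
  "scalar c = Poly_Mapping.single 0 c"

text \<open>
  \<open>exp (h X)\<close> as a formal power series in \<open>h\<close> with coefficients in the free algebra
  (the library's \<^const>\<open>fps_exp\<close> needs coefficients in a field).
\<close>

definition exp_h :: "free_alg \<Rightarrow> free_alg fps" where
  "exp_h X = Abs_fps (\<lambda>n. scalar (1 / fact n) * X ^ n)"

text \<open>
  \<^term>\<open>\<alpha> k l\<close> is the coefficient of stage \<^term>\<open>k\<close> and operator \<^term>\<open>l\<close>; only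
  the values with \<^prop>\<open>1 \<le> k \<and> k \<le> s\<close> and \<^prop>\<open>1 \<le> l \<and> l \<le> N\<close> matter. The products
  are ordered from left to right by increasing index.
\<close>

definition splitting_series :: "nat \<Rightarrow> nat \<Rightarrow> (nat \<Rightarrow> nat \<Rightarrow> complex) \<Rightarrow> free_alg fps" where
  "splitting_series s N \<alpha> =
     prod_list (map (\<lambda>k. prod_list (map (\<lambda>l. exp_h (scalar (\<alpha> k l) * indet l)) [1..<Suc N]))
                    [1..<Suc s])"

definition exact_series :: "nat \<Rightarrow> free_alg fps" where
  "exact_series N = exp_h (\<Sum>l=1..N. indet l)"

text \<open>Order \<^term>\<open>p\<close> means order at least \<^term>\<open>p\<close>: agreement modulo \<open>h\<^sup>p\<^sup>+\<^sup>1\<close>.\<close>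

definition has_order :: "nat \<Rightarrow> nat \<Rightarrow> nat \<Rightarrow> (nat \<Rightarrow> nat \<Rightarrow> complex) \<Rightarrow> bool" where
  "has_order p s N \<alpha> \<longleftrightarrow> (\<forall>n\<le>p. splitting_series s N \<alpha> $ n = exact_series N $ n)"

end

theory Submission
  imports Defs
begin

text \<open>
  A series with constant term \<open>1\<close> is determined modulo \<open>h\<^sup>3\<close> by its linear part and its
  quadratic part, and both are read off word by word. Write \<open>a\<^sub>l\<close> and \<open>b\<^sub>l\<close> for the
  coefficients of the two stages. One stage has linear part \<open>\<Sum> a\<^sub>l D\<^sub>l\<close>, and because its
  factors are ordered by increasing index, its quadratic part contains \<open>D\<^sub>l D\<^sub>m\<close> only for
  \<open>l \<le> m\<close> (lemma \<open>stage_nth_2\<close>). A word \<open>D\<^sub>l D\<^sub>m\<close> with \<open>l > m\<close> thus arises only by taking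
  \<open>D\<^sub>l\<close> from the first stage and \<open>D\<^sub>m\<close> from the second. Comparison with the exponential
  of the sum, all of whose quadratic words have coefficient \<open>1/2\<close>, gives
  \<open>a\<^sub>l + b\<^sub>l = 1\<close> for all \<open>l\<close> and \<open>a\<^sub>l b\<^sub>m = 1/2\<close> for \<open>l > m\<close>; the equations for \<open>l \<le> m\<close>
  follow from these (lemma \<open>has_order_2_iff\<close>).

  For \<open>N > 2\<close> these equations are rigid. All \<open>a\<^sub>l\<close> with \<open>l \<ge> 2\<close> equal \<open>1 / (2 b\<^sub>1)\<close>, so they
  share one value \<open>c\<close>. The pair \<open>(3,2)\<close>, which exists because \<open>N > 2\<close>, gives
  \<open>c (1 - c) = 1/2\<close>, whose roots are \<open>(1 \<plusminus> \<i>)/2\<close>, and comparison of the pairs \<open>(3,1)\<close> and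
  \<open>(3,2)\<close> gives \<open>a\<^sub>1 = c\<close> as well.
\<close>

section \<open>Homogeneous elements of degree one and two\<close>

definition linear_form :: "nat \<Rightarrow> (nat \<Rightarrow> complex) \<Rightarrow> free_alg" where
  "linear_form N a = (\<Sum>l=1..N. Poly_Mapping.single (Word [l]) (a l))"

definition quadratic_form :: "nat \<Rightarrow> (nat \<Rightarrow> nat \<Rightarrow> complex) \<Rightarrow> free_alg" where
  "quadratic_form N q = (\<Sum>l=1..N. \<Sum>m=1..N. Poly_Mapping.single (Word [l, m]) (q l m))"

lemma lookup_linear_form:
  assumes "l \<in> {1..N}"
  shows "Poly_Mapping.lookup (linear_form N a) (Word [l]) = a l"
  using assms
  by (simp add: linear_form_def Poly_Mapping.lookup_sum Poly_Mapping.lookup_single when_def)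

lemma lookup_quadratic_form:
  assumes "l \<in> {1..N}" "m \<in> {1..N}"
  shows "Poly_Mapping.lookup (quadratic_form N q) (Word [l, m]) = q l m"
proof -
  have "Poly_Mapping.lookup (quadratic_form N q) (Word [l, m]) =
        (\<Sum>i=1..N. if i = l then \<Sum>j=1..N. if j = m then q i j else 0 else 0)"
    unfolding quadratic_form_def Poly_Mapping.lookup_sum
    by (intro sum.cong) (auto simp: Poly_Mapping.lookup_single when_def)
  then show ?thesis
    using assms by simp
qed

lemma linear_form_eq_iff:
  "linear_form N a = linear_form N b \<longleftrightarrow> (\<forall>l\<in>{1..N}. a l = b l)"
proof
  assume "linear_form N a = linear_form N b"
  then show "\<forall>l\<in>{1..N}. a l = b l"
    by (metis lookup_linear_form)
next
  assume "\<forall>l\<in>{1..N}. a l = b l"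
  then show "linear_form N a = linear_form N b"
    by (simp add: linear_form_def)
qed

lemma quadratic_form_eq_iff:
  "quadratic_form N q = quadratic_form N r \<longleftrightarrow> (\<forall>l\<in>{1..N}. \<forall>m\<in>{1..N}. q l m = r l m)"
proof
  assume "quadratic_form N q = quadratic_form N r"
  then show "\<forall>l\<in>{1..N}. \<forall>m\<in>{1..N}. q l m = r l m"
    by (metis lookup_quadratic_form)
next
  assume "\<forall>l\<in>{1..N}. \<forall>m\<in>{1..N}. q l m = r l m"
  then show "quadratic_form N q = quadratic_form N r"
    by (simp add: quadratic_form_def)
qed

lemma linear_form_add: "linear_form N a + linear_form N b = linear_form N (\<lambda>l. a l + b l)"
  by (simp add: linear_form_def sum.distrib Poly_Mapping.single_add)

lemma quadratic_form_add:
  "quadratic_form N q + quadratic_form N r = quadratic_form N (\<lambda>l m. q l m + r l m)"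
  by (simp add: quadratic_form_def sum.distrib Poly_Mapping.single_add)

lemma linear_form_mult:
  "linear_form N a * linear_form N b = quadratic_form N (\<lambda>l m. a l * b m)"
  by (simp add: linear_form_def quadratic_form_def sum_product Poly_Mapping.mult_single
      plus_free_monoid_def)

lemma scalar_mult_single:
  "scalar c * Poly_Mapping.single w d = Poly_Mapping.single w (c * d)"
  by (simp add: scalar_def Poly_Mapping.mult_single)

lemma scalar_mult_quadratic_form:
  "scalar c * quadratic_form N q = quadratic_form N (\<lambda>l m. c * q l m)"
  by (simp add: quadratic_form_def sum_distrib_left scalar_mult_single)

lemma scalar_mult_indet: "scalar c * indet l = Poly_Mapping.single (Word [l]) c"
  by (simp add: indet_def scalar_mult_single)

lemma sum_indet: "(\<Sum>l=1..N. indet l) = linear_form N (\<lambda>_. 1)"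
  by (simp add: linear_form_def indet_def)

section \<open>Series modulo the cube of the step size\<close>

lemma scalar_1: "scalar 1 = 1"
  by (simp add: scalar_def)

lemma exp_h_nth_0: "exp_h X $ 0 = 1"
  by (simp add: exp_h_def scalar_1)

lemma exp_h_nth_1: "exp_h X $ 1 = X"
  by (simp add: exp_h_def scalar_1)

lemma exp_h_nth_2: "exp_h X $ 2 = scalar (1 / 2) * (X * X)"
  by (simp add: exp_h_def power2_eq_square)

lemma fps_mult_nth_2:
  fixes f g :: "'a :: semiring_1 fps"
  assumes "f $ 0 = 1" "g $ 0 = 1"
  shows "(f * g) $ 2 = f $ 2 + f $ 1 * g $ 1 + g $ 2"
  using assms by (simp add: fps_mult_nth numeral_2_eq_2 algebra_simps)

definition stage :: "nat \<Rightarrow> (nat \<Rightarrow> complex) \<Rightarrow> free_alg fps" where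
  "stage N a = prod_list (map (\<lambda>l. exp_h (scalar (a l) * indet l)) [1..<Suc N])"

lemma stage_0: "stage 0 a = 1"
  by (simp add: stage_def)

lemma stage_Suc: "stage (Suc n) a = stage n a * exp_h (scalar (a (Suc n)) * indet (Suc n))"
  by (simp add: stage_def)

lemma stage_nth_0: "stage n a $ 0 = 1"
  by (induction n) (simp_all add: stage_0 stage_Suc exp_h_nth_0)

lemma stage_nth_1: "stage n a $ 1 = linear_form n a"
proof (induction n)
  case 0
  show ?case by (simp add: stage_0 linear_form_def)
next
  case (Suc n)
  then show ?case
    using exp_h_nth_1[of "scalar (a (Suc n)) * indet (Suc n)"]
    by (simp add: stage_Suc fps_mult_nth stage_nth_0 exp_h_nth_0 scalar_mult_indet linear_form_def)
qed

text \<open>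
  Two distinct factors of a stage contribute \<open>D\<^sub>l D\<^sub>m\<close> only in the order in which they are
  multiplied, so words with \<open>l > m\<close> are absent; the square \<open>D\<^sub>l D\<^sub>l\<close> comes from the
  quadratic term of a single exponential, whence the factor \<open>1/2\<close>.
\<close>

lemma stage_nth_2:
  "stage n a $ 2 =
     quadratic_form n (\<lambda>l m. if l < m then a l * a m else if l = m then a l ^ 2 / 2 else 0)"
    (is "_ = quadratic_form n ?q")
proof (induction n)
  case 0
  show ?case by (simp add: stage_0 quadratic_form_def)
next
  case (Suc n)
  let ?x = "Poly_Mapping.single (Word [Suc n]) (a (Suc n)) :: free_alg"
  have new_square: "scalar (1 / 2) * (?x * ?x) =
      Poly_Mapping.single (Word [Suc n, Suc n]) (?q (Suc n) (Suc n))"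
    by (simp add: Poly_Mapping.mult_single scalar_mult_single plus_free_monoid_def
        power2_eq_square)
  have new_column: "linear_form n a * ?x =
      (\<Sum>l=1..n. Poly_Mapping.single (Word [l, Suc n]) (?q l (Suc n)))"
    by (simp add: linear_form_def sum_distrib_right Poly_Mapping.mult_single plus_free_monoid_def)
  have new_row: "(\<Sum>m=1..n. Poly_Mapping.single (Word [Suc n, m]) (?q (Suc n) m)) = (0 :: free_alg)"
    by (intro sum.neutral) auto
  have "stage (Suc n) a $ 2 =
      quadratic_form n ?q + linear_form n a * ?x + scalar (1 / 2) * (?x * ?x)"
    by (simp only: stage_Suc fps_mult_nth_2 stage_nth_0 exp_h_nth_0 Suc.IH stage_nth_1
        exp_h_nth_1 exp_h_nth_2 scalar_mult_indet)
  also have "\<dots> = quadratic_form (Suc n) ?q"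
    unfolding new_square new_column
    using new_row by (simp add: quadratic_form_def sum.distrib)
  finally show ?case .
qed

section \<open>The order conditions\<close>

lemma splitting_series_2: "splitting_series 2 N \<alpha> = stage N (\<alpha> 1) * stage N (\<alpha> 2)"
  by (simp add: splitting_series_def stage_def numeral_2_eq_2)

lemma splitting_series_2_nth_1:
  "splitting_series 2 N \<alpha> $ 1 = linear_form N (\<lambda>l. \<alpha> 1 l + \<alpha> 2 l)"
  using stage_nth_1[of N "\<alpha> 1"] stage_nth_1[of N "\<alpha> 2"]
  by (simp add: splitting_series_2 fps_mult_nth stage_nth_0 flip: linear_form_add)

lemma splitting_series_2_nth_2:
  "splitting_series 2 N \<alpha> $ 2 = quadratic_form N
     (\<lambda>l m. if l < m then \<alpha> 1 l * \<alpha> 1 m + \<alpha> 1 l * \<alpha> 2 m + \<alpha> 2 l * \<alpha> 2 m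
            else if l = m then (\<alpha> 1 l + \<alpha> 2 l) ^ 2 / 2
            else \<alpha> 1 l * \<alpha> 2 m)"
  unfolding splitting_series_2 fps_mult_nth_2[OF stage_nth_0 stage_nth_0]
    stage_nth_1 stage_nth_2 linear_form_mult quadratic_form_add quadratic_form_eq_iff
  by (auto simp: power2_eq_square field_simps)

lemma exact_series_nth_1: "exact_series N $ 1 = linear_form N (\<lambda>_. 1)"
  unfolding exact_series_def exp_h_nth_1 sum_indet ..

lemma exact_series_nth_2: "exact_series N $ 2 = quadratic_form N (\<lambda>_ _. 1 / 2)"
  unfolding exact_series_def exp_h_nth_2 sum_indet linear_form_mult scalar_mult_quadratic_form
  by simp

text \<open>
  Once \<open>a\<^sub>l + b\<^sub>l = 1\<close> for all \<open>l\<close>, the words \<open>D\<^sub>l D\<^sub>l\<close> have coefficient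
  \<open>(a\<^sub>l + b\<^sub>l)\<^sup>2 / 2 = 1/2\<close>, and for \<open>l \<noteq> m\<close> the coefficients of \<open>D\<^sub>l D\<^sub>m\<close> and \<open>D\<^sub>m D\<^sub>l\<close> add up to
  \<open>(a\<^sub>l + b\<^sub>l) (a\<^sub>m + b\<^sub>m) = 1\<close>. One of these two is \<open>1/2\<close> if and only if the other is, so
  the words with decreasing indices carry all that remains of the quadratic conditions.
\<close>

lemma has_order_2_iff:
  "has_order 2 2 N \<alpha> \<longleftrightarrow>
     (\<forall>l\<in>{1..N}. \<alpha> 1 l + \<alpha> 2 l = 1) \<and>
     (\<forall>l\<in>{1..N}. \<forall>m\<in>{1..N}. m < l \<longrightarrow> \<alpha> 1 l * \<alpha> 2 m = 1 / 2)"
    (is "_ \<longleftrightarrow> ?linear \<and> ?decreasing")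
proof -
  let ?q = "\<lambda>l m. if l < m then \<alpha> 1 l * \<alpha> 1 m + \<alpha> 1 l * \<alpha> 2 m + \<alpha> 2 l * \<alpha> 2 m
                  else if l = m then (\<alpha> 1 l + \<alpha> 2 l) ^ 2 / 2
                  else \<alpha> 1 l * \<alpha> 2 m"
  have constant_term: "splitting_series 2 N \<alpha> $ 0 = exact_series N $ 0"
    by (simp add: splitting_series_2 stage_nth_0 exact_series_def exp_h_nth_0)
  have up_to_2: "n \<le> 2 \<longleftrightarrow> n = 0 \<or> n = 1 \<or> n = 2" for n :: nat
    by auto
  have "has_order 2 2 N \<alpha> \<longleftrightarrow>
      splitting_series 2 N \<alpha> $ 1 = exact_series N $ 1 \<and>
      splitting_series 2 N \<alpha> $ 2 = exact_series N $ 2"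
    unfolding has_order_def up_to_2 using constant_term by blast
  also have "\<dots> \<longleftrightarrow> ?linear \<and> (\<forall>l\<in>{1..N}. \<forall>m\<in>{1..N}. ?q l m = 1 / 2)"
    unfolding splitting_series_2_nth_1 splitting_series_2_nth_2 exact_series_nth_1
      exact_series_nth_2 linear_form_eq_iff quadratic_form_eq_iff ..
  also have "\<dots> \<longleftrightarrow> ?linear \<and> ?decreasing"
  proof (intro conj_cong refl iffI ballI impI)
    fix l m
    assume "\<forall>l\<in>{1..N}. \<forall>m\<in>{1..N}. ?q l m = 1 / 2" "l \<in> {1..N}" "m \<in> {1..N}" "m < l"
    then have "?q l m = 1 / 2"
      by blast
    then show "\<alpha> 1 l * \<alpha> 2 m = 1 / 2"
      using \<open>m < l\<close> by simp
  next
    fix l m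
    assume linear: ?linear and decreasing: ?decreasing and lm: "l \<in> {1..N}" "m \<in> {1..N}"
    consider "l < m" | "l = m" | "m < l"
      by linarith
    then show "?q l m = 1 / 2"
    proof cases
      case 1
      have "\<alpha> 1 l * \<alpha> 1 m + \<alpha> 1 l * \<alpha> 2 m + \<alpha> 2 l * \<alpha> 2 m =
          (\<alpha> 1 l + \<alpha> 2 l) * (\<alpha> 1 m + \<alpha> 2 m) - \<alpha> 1 m * \<alpha> 2 l"
        by (simp add: algebra_simps)
      also have "\<dots> = 1 / 2"
        using linear decreasing lm 1 by simp
      finally show ?thesis
        using 1 by simp
    next
      case 2
      then show ?thesis
        using linear lm by simp
    next
      case 3
      then show ?thesis
        using decreasing lm by simp
    qed
  qed
  finally show ?thesis .
qed

section \<open>Solving the order conditions\<close>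

lemma mult_one_minus_eq_half_iff:
  fixes c :: complex
  shows "c * (1 - c) = 1 / 2 \<longleftrightarrow> c = 1 / 2 + \<i> / 2 \<or> c = 1 / 2 - \<i> / 2"
proof -
  have "(c - (1 / 2 + \<i> / 2)) * (c - (1 / 2 - \<i> / 2)) = 1 / 2 - c * (1 - c)"
    by (simp add: algebra_simps)
  then show ?thesis
    by (metis eq_iff_diff_eq_0 mult_eq_0_iff)
qed

theorem theorem3p1:
  fixes N :: nat and \<alpha> :: "nat \<Rightarrow> nat \<Rightarrow> complex"
  assumes "N > 2"
  shows "has_order 2 2 N \<alpha> \<longleftrightarrow>
    (\<forall>l\<in>{1..N}. \<alpha> 1 l = 1 / 2 + \<i> / 2 \<and> \<alpha> 2 l = 1 / 2 - \<i> / 2) \<or>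
    (\<forall>l\<in>{1..N}. \<alpha> 1 l = 1 / 2 - \<i> / 2 \<and> \<alpha> 2 l = 1 / 2 + \<i> / 2)"
proof
  assume "has_order 2 2 N \<alpha>"
  then have linear: "\<alpha> 2 l = 1 - \<alpha> 1 l" if "l \<in> {1..N}" for l
    using that unfolding has_order_2_iff by (metis add_diff_cancel_left')
  have decreasing: "\<alpha> 1 l * (1 - \<alpha> 1 m) = 1 / 2" if "l \<in> {1..N}" "m \<in> {1..N}" "m < l" for l m
    using \<open>has_order 2 2 N \<alpha>\<close> that linear[of m] unfolding has_order_2_iff by metis
  define c where "c = \<alpha> 1 3"
  have c_1: "c * (1 - \<alpha> 1 1) = 1 / 2" and c_2: "c * (1 - \<alpha> 1 2) = 1 / 2"
    using decreasing[of 3 1] decreasing[of 3 2] assms by (auto simp: c_def)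
  then have nonzero: "c \<noteq> 0" "1 - \<alpha> 1 1 \<noteq> 0"
    by auto
  have ge_2: "\<alpha> 1 l = c" if "l \<in> {1..N}" "1 < l" for l
    using decreasing[of l 1] that c_1 nonzero(2) assms
    by (metis atLeastAtMost_iff le_trans less_imp_le mult_right_cancel order_refl)
  have "\<alpha> 1 1 = \<alpha> 1 2"
    using c_1 c_2 nonzero(1) by (metis diff_diff_eq2 mult_left_cancel add_diff_cancel_left')
  moreover have two: "\<alpha> 1 2 = c"
    using ge_2[of 2] assms by simp
  ultimately have all: "\<alpha> 1 l = c" if "l \<in> {1..N}" for l
    using ge_2[of l] that by (cases "l = 1") auto
  have "c = 1 / 2 + \<i> / 2 \<or> c = 1 / 2 - \<i> / 2"
    using c_2 unfolding two mult_one_minus_eq_half_iff .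
  then show "(\<forall>l\<in>{1..N}. \<alpha> 1 l = 1 / 2 + \<i> / 2 \<and> \<alpha> 2 l = 1 / 2 - \<i> / 2) \<or>
    (\<forall>l\<in>{1..N}. \<alpha> 1 l = 1 / 2 - \<i> / 2 \<and> \<alpha> 2 l = 1 / 2 + \<i> / 2)"
  proof
    assume "c = 1 / 2 + \<i> / 2"
    then show ?thesis
      using all linear by simp
  next
    assume "c = 1 / 2 - \<i> / 2"
    then show ?thesis
      using all linear by simp
  qed
next
  assume "(\<forall>l\<in>{1..N}. \<alpha> 1 l = 1 / 2 + \<i> / 2 \<and> \<alpha> 2 l = 1 / 2 - \<i> / 2) \<or>
    (\<forall>l\<in>{1..N}. \<alpha> 1 l = 1 / 2 - \<i> / 2 \<and> \<alpha> 2 l = 1 / 2 + \<i> / 2)"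
  then show "has_order 2 2 N \<alpha>"
  proof
    assume "\<forall>l\<in>{1..N}. \<alpha> 1 l = 1 / 2 + \<i> / 2 \<and> \<alpha> 2 l = 1 / 2 - \<i> / 2"
    moreover have "(1 / 2 + \<i> / 2) * (1 / 2 - \<i> / 2) = 1 / 2"
      by (simp add: algebra_simps)
    ultimately show ?thesis
      unfolding has_order_2_iff by simp
  next
    assume "\<forall>l\<in>{1..N}. \<alpha> 1 l = 1 / 2 - \<i> / 2 \<and> \<alpha> 2 l = 1 / 2 + \<i> / 2"
    moreover have "(1 / 2 - \<i> / 2) * (1 / 2 + \<i> / 2) = 1 / 2"
      by (simp add: algebra_simps)
    ultimately show ?thesis
      unfolding has_order_2_iff by simp
  qed
qed

end
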